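(* Let $n\ge k\ge 1$ be integers and let $X_1,\dots,X_n$ be mutually independent non-negative random variables with finite expectations. Let $\mathcal{A}^*$ be the maximum, over all adaptive probing policies, of the expected maximum value sampled, and let $$\mathcal{U}^* = \min_{r\in\mathbb{R}}\ \max_{S\subseteq[n],\,|S|=k}\ \Big(r+\sum_{i\in S}\mathbb{E}\big[[X_i-r]^+\big]\Big).$$ Then $\mathcal{A}^*\le \mathcal{U}^*$.
   Context: $[n]=\{1,\dots,n\}$ and $[x]^+=\max\{x,0\}$. An adaptive probing policy is a function $P$ that, given a state $(\kappa,r,T)$ with $\kappa\in\{1,\dots,k\}$ (number of probes remaining), $r\ge 0$ (maximal value sampled so far) and $T\subseteq[n]$ (indices not yet probed), returns an index $P(\kappa,r,T)\in T$ to probe next. Starting from state $(k,0,[n])$, the policy probes $X_{P(\kappa,r,T)}$, observes its realization, and moves to state $(\kappa-1,\max\{r,X_{P(\kappa,r,T)}\},T\setminus\{P(\kappa,r,T)\})$; at a state $(0,r,T)$ the process stops and the reward is $r$. Formally, $\mathcal{A}_P(0,r,T)=r$ and $\mathcal{A}_P(\kappa,r,T)=\mathbb{E}[\mathcal{A}_P(\kappa-1,\max\{r,X_{P(\kappa,r,T)}\},T\setminus\{P(\kappa,r,T)\})]$ for $\kappa\ge1$, the expectation over $X_{P(\kappa,r,T)}$; the policy's value is $\mathcal{A}_P(k,0,[n])$, and $\mathcal{A}^*$ is the maximum of this over policies. *)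

theory Defs
  imports "HOL-Probability.Probability"
begin

text \<open>
  A policy maps a state (probes remaining, maximal value sampled so far, indices not yet probed)
  to the index to probe next. As the probe budget is at most the number of variables, no state
  with probes remaining and no index left is ever reached, so nothing is required there.
\<close>

type_synonym probing_policy = "nat \<Rightarrow> real \<Rightarrow> nat set \<Rightarrow> nat"

definition probing_policies :: "nat \<Rightarrow> nat \<Rightarrow> probing_policy set" where
  "probing_policies n k =
     {P. \<forall>\<kappa>\<in>{1..k}. \<forall>r\<ge>0. \<forall>T. T \<subseteq> {1..n} \<and> T \<noteq> {} \<longrightarrow> P \<kappa> r T \<in> T}"

text \<open>
  Policies need not be measurable in the maximal value sampled so far. If the integrand in the
  recursion is not integrable, the Bochner integral is \<open>0\<close> by convention. This does not affect
  the optimum: lemma \<open>adaptive_opt_attained\<close> below shows that it is attained by a measurable policy.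
\<close>

fun policy_value ::
  "'a measure \<Rightarrow> (nat \<Rightarrow> 'a \<Rightarrow> real) \<Rightarrow> probing_policy \<Rightarrow> nat \<Rightarrow> real \<Rightarrow> nat set \<Rightarrow> real" where
  "policy_value M X P 0 r T = r"
| "policy_value M X P (Suc \<kappa>) r T =
     (\<integral>\<omega>. policy_value M X P \<kappa> (max r (X (P (Suc \<kappa>) r T) \<omega>)) (T - {P (Suc \<kappa>) r T}) \<partial>M)"

definition adaptive_opt :: "'a measure \<Rightarrow> (nat \<Rightarrow> 'a \<Rightarrow> real) \<Rightarrow> nat \<Rightarrow> nat \<Rightarrow> real" where
  "adaptive_opt M X n k = (SUP P\<in>probing_policies n k. policy_value M X P k 0 {1..n})"

definition threshold_bound :: "'a measure \<Rightarrow> (nat \<Rightarrow> 'a \<Rightarrow> real) \<Rightarrow> nat \<Rightarrow> nat \<Rightarrow> real \<Rightarrow> real" where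
  "threshold_bound M X n k r =
     Max ((\<lambda>S. r + (\<Sum>i\<in>S. \<integral>\<omega>. max (X i \<omega> - r) 0 \<partial>M)) ` {S. S \<subseteq> {1..n} \<and> card S = k})"

definition upper_opt :: "'a measure \<Rightarrow> (nat \<Rightarrow> 'a \<Rightarrow> real) \<Rightarrow> nat \<Rightarrow> nat \<Rightarrow> real" where
  "upper_opt M X n k = (INF r. threshold_bound M X n k r)"


subsection \<open>The supremum is a maximum and the infimum is a minimum\<close>

lemma abs_Max_diff_le:
  fixes f g :: "'b \<Rightarrow> real"
  assumes "finite A" "A \<noteq> {}" "\<And>a. a \<in> A \<Longrightarrow> \<bar>f a - g a\<bar> \<le> c"
  shows "\<bar>Max (f ` A) - Max (g ` A)\<bar> \<le> c"
proof -
  have *: "Max (u ` A) \<le> Max (v ` A) + c"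
    if uv: "\<And>a. a \<in> A \<Longrightarrow> u a \<le> v a + c" for u v :: "'b \<Rightarrow> real"
  proof -
    have "u a \<le> Max (v ` A) + c" if "a \<in> A" for a
    proof -
      have "v a \<le> Max (v ` A)" using that assms(1) by (intro Max_ge) auto
      with uv[OF that] show ?thesis by linarith
    qed
    then show ?thesis using assms(1,2) by (subst Max_le_iff) auto
  qed
  have "Max (f ` A) \<le> Max (g ` A) + c" by (rule *) (use assms(3) in force)
  moreover have "Max (g ` A) \<le> Max (f ` A) + c" by (rule *) (use assms(3) in force)
  ultimately show ?thesis by linarith
qed

lemma continuous_on_if_Lipschitz:
  fixes f :: "real \<Rightarrow> real"
  assumes "\<And>x y. \<bar>f x - f y\<bar> \<le> L * \<bar>x - y\<bar>" "L \<ge> 0"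
  shows "continuous_on A f"
  by (rule lipschitz_on_continuous_on[of L]) (auto intro!: lipschitz_onI simp: dist_real_def assms)

fun dp_value :: "'a measure \<Rightarrow> (nat \<Rightarrow> 'a \<Rightarrow> real) \<Rightarrow> nat \<Rightarrow> real \<Rightarrow> nat set \<Rightarrow> real" where
  "dp_value M X 0 r T = r"
| "dp_value M X (Suc \<kappa>) r T =
     Max ((\<lambda>i. \<integral>\<omega>. dp_value M X \<kappa> (max r (X i \<omega>)) (T - {i}) \<partial>M) ` T)"

definition dp_policy :: "'a measure \<Rightarrow> (nat \<Rightarrow> 'a \<Rightarrow> real) \<Rightarrow> nat \<Rightarrow> real \<Rightarrow> nat set \<Rightarrow> nat" where
  "dp_policy M X \<kappa> r T = (LEAST i. i \<in> T \<and>
     (\<forall>j\<in>T. (\<integral>\<omega>. dp_value M X (\<kappa> - 1) (max r (X j \<omega>)) (T - {j}) \<partial>M)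
           \<le> (\<integral>\<omega>. dp_value M X (\<kappa> - 1) (max r (X i \<omega>)) (T - {i}) \<partial>M)))"

context prob_space
begin

lemma integrable_Lipschitz_max:
  fixes f :: "real \<Rightarrow> real"
  assumes lip: "\<And>x y. \<bar>f x - f y\<bar> \<le> \<bar>x - y\<bar>" and Y: "integrable M Y"
  shows "integrable M (\<lambda>\<omega>. f (max r (Y \<omega>)))"
proof (rule Bochner_Integration.integrable_bound)
  show "integrable M (\<lambda>\<omega>. \<bar>f 0\<bar> + \<bar>max r (Y \<omega>)\<bar>)" using Y by auto
  have "continuous_on UNIV f"
    by (rule continuous_on_if_Lipschitz[of _ 1]) (use lip in auto)
  then have [measurable]: "f \<in> borel_measurable borel"
    by (rule borel_measurable_continuous_onI)
  have [measurable]: "Y \<in> borel_measurable M" using Y by auto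
  show "(\<lambda>\<omega>. f (max r (Y \<omega>))) \<in> borel_measurable M" by measurable
  have "\<bar>f x\<bar> \<le> \<bar>f 0\<bar> + \<bar>x\<bar>" for x using lip[of x 0] by simp
  then show "AE \<omega> in M. norm (f (max r (Y \<omega>))) \<le> norm (\<bar>f 0\<bar> + \<bar>max r (Y \<omega>)\<bar>)"
    by (auto intro: order_trans)
qed

lemma expectation_Lipschitz:
  fixes f g :: "'a \<Rightarrow> real"
  assumes "integrable M f" "integrable M g" "\<And>\<omega>. \<bar>f \<omega> - g \<omega>\<bar> \<le> c"
  shows "\<bar>expectation f - expectation g\<bar> \<le> c"
proof -
  have "\<bar>expectation f - expectation g\<bar> = \<bar>expectation (\<lambda>\<omega>. f \<omega> - g \<omega>)\<bar>"
    using assms by simp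
  also have "\<dots> \<le> expectation (\<lambda>\<omega>. \<bar>f \<omega> - g \<omega>\<bar>)" by (rule integral_abs_bound)
  also have "\<dots> \<le> expectation (\<lambda>\<omega>. c)" by (rule integral_mono) (use assms in auto)
  finally show ?thesis by (simp add: prob_space)
qed

lemma dp_value_Lipschitz:
  assumes "\<And>i. i \<in> T \<Longrightarrow> integrable M (X i)" "finite T" "\<kappa> \<le> card T"
  shows "\<bar>dp_value M X \<kappa> r T - dp_value M X \<kappa> s T\<bar> \<le> \<bar>r - s\<bar>"
  using assms
proof (induction \<kappa> arbitrary: r s T)
  case (Suc \<kappa>)
  have lip: "\<bar>dp_value M X \<kappa> x (T - {i}) - dp_value M X \<kappa> y (T - {i})\<bar> \<le> \<bar>x - y\<bar>"
    if "i \<in> T" for i x y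
    by (rule Suc.IH) (use Suc.prems that in auto)
  show ?case unfolding dp_value.simps
  proof (rule abs_Max_diff_le)
    show "T \<noteq> {}" using Suc.prems by auto
    fix i assume i: "i \<in> T"
    show "\<bar>expectation (\<lambda>\<omega>. dp_value M X \<kappa> (max r (X i \<omega>)) (T - {i}))
         - expectation (\<lambda>\<omega>. dp_value M X \<kappa> (max s (X i \<omega>)) (T - {i}))\<bar> \<le> \<bar>r - s\<bar>"
    proof (rule expectation_Lipschitz)
      have *: "integrable M (\<lambda>\<omega>. dp_value M X \<kappa> (max r (X i \<omega>)) (T - {i}))" for r
        by (rule integrable_Lipschitz_max[where f = "\<lambda>x. dp_value M X \<kappa> x (T - {i})"])
           (use lip i Suc.prems in auto)
      show "integrable M (\<lambda>\<omega>. dp_value M X \<kappa> (max r (X i \<omega>)) (T - {i}))" by (rule *)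
      show "integrable M (\<lambda>\<omega>. dp_value M X \<kappa> (max s (X i \<omega>)) (T - {i}))" by (rule *)
      show "\<bar>dp_value M X \<kappa> (max r (X i \<omega>)) (T - {i}) - dp_value M X \<kappa> (max s (X i \<omega>)) (T - {i})\<bar>
          \<le> \<bar>r - s\<bar>" for \<omega>
        by (rule order_trans[OF lip[OF i]]) (auto simp: max_def)
    qed
  qed (use Suc.prems in auto)
qed simp

lemma dp_step_integrable:
  assumes "\<And>i. i \<in> T \<Longrightarrow> integrable M (X i)" "finite T" "Suc \<kappa> \<le> card T" "i \<in> T"
  shows "integrable M (\<lambda>\<omega>. dp_value M X \<kappa> (max r (X i \<omega>)) (T - {i}))"
  by (rule integrable_Lipschitz_max[where f = "\<lambda>x. dp_value M X \<kappa> x (T - {i})"])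
     (use assms in \<open>auto intro!: dp_value_Lipschitz\<close>)

lemma dp_step_measurable:
  assumes "\<And>i. i \<in> T \<Longrightarrow> integrable M (X i)" "finite T" "Suc \<kappa> \<le> card T" "i \<in> T"
  shows "(\<lambda>r. expectation (\<lambda>\<omega>. dp_value M X \<kappa> (max r (X i \<omega>)) (T - {i}))) \<in> borel_measurable borel"
proof (rule borel_measurable_continuous_onI, rule continuous_on_if_Lipschitz[of _ 1])
  fix r s
  show "\<bar>expectation (\<lambda>\<omega>. dp_value M X \<kappa> (max r (X i \<omega>)) (T - {i}))
       - expectation (\<lambda>\<omega>. dp_value M X \<kappa> (max s (X i \<omega>)) (T - {i}))\<bar> \<le> 1 * \<bar>r - s\<bar>"
  proof (rule expectation_Lipschitz)
    show "\<bar>dp_value M X \<kappa> (max r (X i \<omega>)) (T - {i}) - dp_value M X \<kappa> (max s (X i \<omega>)) (T - {i})\<bar>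
        \<le> 1 * \<bar>r - s\<bar>" for \<omega>
      by (rule order_trans[OF dp_value_Lipschitz]) (use assms in \<open>auto simp: max_def\<close>)
    show "integrable M (\<lambda>\<omega>. dp_value M X \<kappa> (max r (X i \<omega>)) (T - {i}))"
      using assms by (rule dp_step_integrable)
    show "integrable M (\<lambda>\<omega>. dp_value M X \<kappa> (max s (X i \<omega>)) (T - {i}))"
      using assms by (rule dp_step_integrable)
  qed
qed simp

lemma dp_value_ge:
  assumes "\<And>i. i \<in> T \<Longrightarrow> integrable M (X i)" "finite T" "\<kappa> \<le> card T"
  shows "r \<le> dp_value M X \<kappa> r T"
  using assms
proof (induction \<kappa> arbitrary: r T)
  case (Suc \<kappa>)
  then obtain i where i: "i \<in> T" by fastforce
  have "r = expectation (\<lambda>\<omega>. r)" by (simp add: prob_space)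
  also have "\<dots> \<le> expectation (\<lambda>\<omega>. dp_value M X \<kappa> (max r (X i \<omega>)) (T - {i}))"
  proof (rule integral_mono)
    fix \<omega>
    have "max r (X i \<omega>) \<le> dp_value M X \<kappa> (max r (X i \<omega>)) (T - {i})"
      by (rule Suc.IH) (use Suc.prems i in auto)
    then show "r \<le> dp_value M X \<kappa> (max r (X i \<omega>)) (T - {i})" by simp
  qed (use Suc.prems i in \<open>auto intro!: dp_step_integrable\<close>)
  also have "\<dots> \<le> dp_value M X (Suc \<kappa>) r T"
    unfolding dp_value.simps by (rule Max_ge) (use Suc.prems i in auto)
  finally show ?case .
qed simp

lemma policy_value_le_dp_value:
  assumes "\<And>i. i \<in> {1..n} \<Longrightarrow> integrable M (X i)" "P \<in> probing_policies n k"
    and "T \<subseteq> {1..n}" "\<kappa> \<le> card T" "\<kappa> \<le> k" "r \<ge> 0"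
  shows "policy_value M X P \<kappa> r T \<le> dp_value M X \<kappa> r T"
  using assms(3-)
proof (induction \<kappa> arbitrary: r T)
  case (Suc \<kappa>)
  define i where "i = P (Suc \<kappa>) r T"
  have fin: "finite T" using Suc.prems(1) finite_subset by blast
  have "T \<noteq> {}" using Suc.prems by auto
  then have i: "i \<in> T" using assms(2) Suc.prems unfolding probing_policies_def i_def by auto
  have int: "\<And>i. i \<in> T \<Longrightarrow> integrable M (X i)" using assms(1) Suc.prems by blast
  let ?v = "\<lambda>\<omega>. policy_value M X P \<kappa> (max r (X i \<omega>)) (T - {i})"
  let ?d = "\<lambda>\<omega>. dp_value M X \<kappa> (max r (X i \<omega>)) (T - {i})"
  have d: "integrable M ?d" using int fin Suc.prems i by (intro dp_step_integrable) auto
  have "expectation ?v \<le> expectation ?d"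
  proof (cases "integrable M ?v")
    case True
    show ?thesis
    proof (rule integral_mono[OF True d])
      show "?v \<omega> \<le> ?d \<omega>" for \<omega>
        by (rule Suc.IH) (use Suc.prems fin i in auto)
    qed
  next
    case False
    have "max r (X i \<omega>) \<le> ?d \<omega>" for \<omega>
      by (rule dp_value_ge) (use int fin i Suc.prems in auto)
    then have "0 \<le> ?d \<omega>" for \<omega>
      using \<open>r \<ge> 0\<close> by (meson max.cobounded1 order_trans)
    then show ?thesis using False by (simp add: not_integrable_integral_eq)
  qed
  also have "\<dots> \<le> dp_value M X (Suc \<kappa>) r T"
    unfolding dp_value.simps by (rule Max_ge) (use fin i in auto)
  finally show ?case by (simp add: i_def)
qed simp

lemma dp_policy_props:
  assumes "finite T" "T \<noteq> {}"
  shows "dp_policy M X \<kappa> r T \<in> T"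
    and "\<kappa> = Suc m \<Longrightarrow> dp_value M X \<kappa> r T = 
           expectation (\<lambda>\<omega>. dp_value M X m (max r (X (dp_policy M X \<kappa> r T) \<omega>)) (T - {dp_policy M X \<kappa> r T}))"
proof -
  define w where "w i = expectation (\<lambda>\<omega>. dp_value M X (\<kappa> - 1) (max r (X i \<omega>)) (T - {i}))" for i
  have "Max (w ` T) \<in> w ` T" using assms by (intro Max_in) auto
  then obtain i where "i \<in> T" "w i = Max (w ` T)" by auto
  then have "i \<in> T \<and> (\<forall>j\<in>T. w j \<le> w i)" using assms by auto
  then have *: "dp_policy M X \<kappa> r T \<in> T \<and> (\<forall>j\<in>T. w j \<le> w (dp_policy M X \<kappa> r T))"
    unfolding dp_policy_def w_def[symmetric] by (rule LeastI)
  then show "dp_policy M X \<kappa> r T \<in> T" by blast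
  have "Max (w ` T) = w (dp_policy M X \<kappa> r T)"
    using * assms by (intro Max_eqI) auto
  then show "dp_value M X \<kappa> r T = 
      expectation (\<lambda>\<omega>. dp_value M X m (max r (X (dp_policy M X \<kappa> r T) \<omega>)) (T - {dp_policy M X \<kappa> r T}))"
    if "\<kappa> = Suc m"
    using that by (simp add: w_def[abs_def])
qed

lemma dp_policy_in: "dp_policy M X \<in> probing_policies n k"
  unfolding probing_policies_def
proof (intro CollectI ballI allI impI)
  fix \<kappa> r T assume "T \<subseteq> {1..n} \<and> T \<noteq> {}"
  then show "dp_policy M X \<kappa> r T \<in> T"
    using finite_subset[of T "{1..n}"] by (intro dp_policy_props(1)) auto
qed

lemma dp_policy_value:
  assumes "finite T" "\<kappa> \<le> card T"
  shows "policy_value M X (dp_policy M X) \<kappa> r T = dp_value M X \<kappa> r T"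
  using assms
proof (induction \<kappa> arbitrary: r T)
  case (Suc \<kappa>)
  define i where "i = dp_policy M X (Suc \<kappa>) r T"
  have T: "T \<noteq> {}" using Suc.prems by auto
  have i: "i \<in> T" unfolding i_def by (rule dp_policy_props(1)) (use Suc.prems T in auto)
  have "policy_value M X (dp_policy M X) \<kappa> s (T - {i}) = dp_value M X \<kappa> s (T - {i})" for s
    by (rule Suc.IH) (use Suc.prems i in auto)
  then show ?case
    using dp_policy_props(2)[OF Suc.prems(1) T refl, of X \<kappa> r]
    unfolding policy_value.simps i_def[symmetric] by simp
qed simp

lemma dp_policy_measurable:
  assumes "\<And>i. i \<in> T \<Longrightarrow> integrable M (X i)" "finite T" "1 \<le> \<kappa>" "\<kappa> \<le> card T"
  shows "(\<lambda>r. dp_policy M X \<kappa> r T) \<in> borel \<rightarrow>\<^sub>M count_space UNIV"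
proof -
  have [measurable]: "(\<lambda>r. expectation (\<lambda>\<omega>. dp_value M X (\<kappa> - 1) (max r (X i \<omega>)) (T - {i})))
      \<in> borel_measurable borel" if "i \<in> T" for i
    by (rule dp_step_measurable) (use assms that in auto)
  have "Measurable.pred borel (\<lambda>r. i \<in> T \<and> (\<forall>j\<in>T.
        expectation (\<lambda>\<omega>. dp_value M X (\<kappa> - 1) (max r (X j \<omega>)) (T - {j}))
      \<le> expectation (\<lambda>\<omega>. dp_value M X (\<kappa> - 1) (max r (X i \<omega>)) (T - {i}))))" for i
  proof (cases "i \<in> T")
    case True
    then have "Measurable.pred borel (\<lambda>r. \<forall>j\<in>T.
        expectation (\<lambda>\<omega>. dp_value M X (\<kappa> - 1) (max r (X j \<omega>)) (T - {j}))
      \<le> expectation (\<lambda>\<omega>. dp_value M X (\<kappa> - 1) (max r (X i \<omega>)) (T - {i})))"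
      using assms(2) by (intro pred_intros_finite) measurable
    then show ?thesis using True by simp
  qed simp
  then show ?thesis unfolding dp_policy_def by (rule measurable_Least)
qed

lemma adaptive_opt_attained:
  assumes "k \<le> n" "\<And>i. i \<in> {1..n} \<Longrightarrow> integrable M (X i)"
  shows "\<exists>P\<in>probing_policies n k.
           (\<forall>\<kappa>\<ge>1. \<forall>T\<subseteq>{1..n}. \<kappa> \<le> card T \<longrightarrow> (\<lambda>r. P \<kappa> r T) \<in> borel \<rightarrow>\<^sub>M count_space UNIV) \<and>
           policy_value M X P k 0 {1..n} = adaptive_opt M X n k"
    and "P \<in> probing_policies n k \<Longrightarrow> policy_value M X P k 0 {1..n} \<le> adaptive_opt M X n k"
proof -
  have le: "policy_value M X Q k 0 {1..n} \<le> policy_value M X (dp_policy M X) k 0 {1..n}"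
    if "Q \<in> probing_policies n k" for Q
  proof -
    have "policy_value M X Q k 0 {1..n} \<le> dp_value M X k 0 {1..n}"
      by (rule policy_value_le_dp_value[OF assms(2) that]) (use assms(1) in auto)
    also have "\<dots> = policy_value M X (dp_policy M X) k 0 {1..n}"
      using assms(1) by (intro dp_policy_value[symmetric]) auto
    finally show ?thesis .
  qed
  have eq: "policy_value M X (dp_policy M X) k 0 {1..n} = adaptive_opt M X n k"
    unfolding adaptive_opt_def using dp_policy_in le
    by (intro cSup_eq_maximum[symmetric]) auto
  have "(\<lambda>r. dp_policy M X \<kappa> r T) \<in> borel \<rightarrow>\<^sub>M count_space UNIV"
    if "\<kappa> \<ge> 1" "T \<subseteq> {1..n}" "\<kappa> \<le> card T" for \<kappa> T
    by (rule dp_policy_measurable) (use that assms finite_subset in auto)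
  with eq dp_policy_in show "\<exists>P\<in>probing_policies n k.
      (\<forall>\<kappa>\<ge>1. \<forall>T\<subseteq>{1..n}. \<kappa> \<le> card T \<longrightarrow> (\<lambda>r. P \<kappa> r T) \<in> borel \<rightarrow>\<^sub>M count_space UNIV) \<and>
      policy_value M X P k 0 {1..n} = adaptive_opt M X n k" by blast
  show "policy_value M X P k 0 {1..n} \<le> adaptive_opt M X n k" if "P \<in> probing_policies n k"
    using le[OF that] eq by simp
qed

lemma upper_opt_attained:
  assumes k: "1 \<le> k" "k \<le> n" and int: "\<And>i. i \<in> {1..n} \<Longrightarrow> integrable M (X i)"
    and nonneg: "\<And>i. i \<in> {1..n} \<Longrightarrow> AE \<omega> in M. 0 \<le> X i \<omega>"
  shows "\<exists>r. threshold_bound M X n k r = upper_opt M X n k"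
    and "upper_opt M X n k \<le> threshold_bound M X n k r"
proof -
  let ?g = "threshold_bound M X n k"
  define A where "A = {S. S \<subseteq> {1..n} \<and> card S = k}"
  define e where "e i r = expectation (\<lambda>\<omega>. max (X i \<omega> - r) 0)" for i r
  have g: "?g r = Max ((\<lambda>S. r + (\<Sum>i\<in>S. e i r)) ` A)" for r
    by (simp add: threshold_bound_def A_def e_def)
  have finA: "finite A" unfolding A_def by (rule finite_subset[of _ "Pow {1..n}"]) auto
  have "{1..k} \<in> A" using k by (auto simp: A_def)
  then have neA: "A \<noteq> {}" by auto
  have int': "integrable M (\<lambda>\<omega>. max (X i \<omega> - r) 0)" if "i \<in> {1..n}" for i r
    using int[OF that] by (intro integrable_max) auto
  have e_lip: "\<bar>e i r - e i s\<bar> \<le> \<bar>r - s\<bar>" if "i \<in> {1..n}" for i r s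
    unfolding e_def by (rule expectation_Lipschitz) (use int'[OF that] in \<open>auto simp: max_def\<close>)
  have e_nonneg: "0 \<le> e i r" for i r
    unfolding e_def by (rule integral_nonneg_AE) auto
  have e_neg: "e i 0 - r \<le> e i r" if "i \<in> {1..n}" "r \<le> 0" for i r
  proof -
    have "e i 0 - r = expectation (\<lambda>\<omega>. max (X i \<omega> - 0) 0 - r)"
      unfolding e_def using int'[OF that(1), of 0] by (simp add: prob_space)
    also have "\<dots> \<le> e i r" unfolding e_def
    proof (rule integral_mono_AE)
      show "AE \<omega> in M. max (X i \<omega> - 0) 0 - r \<le> max (X i \<omega> - r) 0"
        using nonneg[OF that(1)] by eventually_elim auto
      show "integrable M (\<lambda>\<omega>. max (X i \<omega> - 0) 0 - r)"
        by (intro Bochner_Integration.integrable_diff int'[OF that(1)] integrable_const)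
    qed (rule int'[OF that(1)])
    finally show ?thesis .
  qed
  have cont: "continuous_on {0..max 0 (?g 0)} ?g"
  proof (rule continuous_on_if_Lipschitz[of _ "1 + real k"])
    show "\<bar>?g r - ?g s\<bar> \<le> (1 + real k) * \<bar>r - s\<bar>" for r s
      unfolding g
    proof (rule abs_Max_diff_le[OF finA neA])
      fix S assume S: "S \<in> A"
      have "\<bar>(\<Sum>i\<in>S. e i r) - (\<Sum>i\<in>S. e i s)\<bar> \<le> (\<Sum>i\<in>S. \<bar>e i r - e i s\<bar>)"
        by (simp add: sum_subtractf[symmetric] sum_abs)
      also have "\<dots> \<le> (\<Sum>i\<in>S. \<bar>r - s\<bar>)"
        by (rule sum_mono) (use S e_lip in \<open>auto simp: A_def\<close>)
      also have "\<dots> = real k * \<bar>r - s\<bar>" using S by (simp add: A_def)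
      finally show "\<bar>(r + (\<Sum>i\<in>S. e i r)) - (s + (\<Sum>i\<in>S. e i s))\<bar> \<le> (1 + real k) * \<bar>r - s\<bar>"
        by (simp add: algebra_simps)
    qed
  qed simp
  have low: "?g 0 \<le> ?g r" if "r \<le> 0" for r
  proof -
    have "0 + (\<Sum>i\<in>S. e i 0) \<le> ?g r" if S: "S \<in> A" for S
    proof -
      have "(\<Sum>i\<in>S. e i 0) - k * r = (\<Sum>i\<in>S. e i 0 - r)"
        using S by (simp add: A_def sum_subtractf)
      also have "\<dots> \<le> (\<Sum>i\<in>S. e i r)"
        by (rule sum_mono) (use S e_neg \<open>r \<le> 0\<close> in \<open>auto simp: A_def\<close>)
      finally have "(\<Sum>i\<in>S. e i 0) - k * r \<le> (\<Sum>i\<in>S. e i r)" .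
      moreover have "real k * r \<le> 1 * r"
        using k \<open>r \<le> 0\<close> by (intro mult_right_mono_neg) auto
      moreover have "r + (\<Sum>i\<in>S. e i r) \<le> ?g r"
        unfolding g using finA S by (intro Max_ge) auto
      ultimately show ?thesis by linarith
    qed
    then show ?thesis using finA neA by (subst g) (auto simp: Max_le_iff)
  qed
  have high: "r \<le> ?g r" for r
  proof -
    have "r \<le> r + (\<Sum>i\<in>{1..k}. e i r)" using e_nonneg by (simp add: sum_nonneg)
    also have "\<dots> \<le> ?g r" unfolding g using finA \<open>{1..k} \<in> A\<close> by (intro Max_ge) auto
    finally show ?thesis .
  qed
  obtain t where t: "t \<in> {0..max 0 (?g 0)}" "\<And>r. r \<in> {0..max 0 (?g 0)} \<Longrightarrow> ?g t \<le> ?g r"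
    using continuous_attains_inf[OF _ _ cont] by auto
  have min: "?g t \<le> ?g r" for r
  proof (cases "r \<in> {0..max 0 (?g 0)}")
    case False
    have "?g t \<le> ?g 0" by (rule t(2)) auto
    moreover have "?g 0 \<le> ?g r" using False low[of r] high[of r] by auto
    ultimately show ?thesis by linarith
  qed (use t in auto)
  have eq: "?g t = upper_opt M X n k"
    unfolding upper_opt_def using min by (intro cInf_eq_minimum[symmetric]) auto
  then show "\<exists>r. ?g r = upper_opt M X n k" by blast
  show "upper_opt M X n k \<le> ?g r" using min eq by metis
qed

end

end

(*
  For a threshold t and a set S of probed indices, the maximum of s and the sampled values is at
  most max s t + (SUM i:S. max (X i - t) 0). An index is chosen before its value is seen, so each
  probe adds at most its expected excess over t, and every adaptive policy is bounded by max s t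
  plus the largest total expected excess of a set of the same size. Since the variables are
  non-negative and at least one is probed, lowering the initial value 0 to min t 0 does not change
  the reward, and max (min t 0) t = t.
*)
theory Submission
  imports Defs
begin

context prob_space
begin

text \<open>Induction on \<kappa> with \<open>c\<close> arbitrary: a probe of \<open>i\<close> uses
  up the expected excess of \<open>i\<close> over \<open>t\<close>, and the bound \<open>c\<close>
  for the remaining probes shrinks by exactly that amount.\<close>

lemma dp_value_le_threshold:
  assumes "\<And>i. i \<in> T \<Longrightarrow> integrable M (X i)" "finite T" "\<kappa> \<le> card T"
    and "\<And>S. S \<subseteq> T \<Longrightarrow> card S = \<kappa> \<Longrightarrow> (\<Sum>i\<in>S. expectation (\<lambda>\<omega>. max (X i \<omega> - t) 0)) \<le> c"
  shows "dp_value M X \<kappa> s T \<le> max s t + c"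
  using assms
proof (induction \<kappa> arbitrary: s T c)
  case 0
  then have "0 \<le> c" using "0.prems"(4)[of "{}"] by simp
  then show ?case by simp
next
  case (Suc \<kappa>)
  define e where "e i = expectation (\<lambda>\<omega>. max (X i \<omega> - t) 0)" for i
  have step: "expectation (\<lambda>\<omega>. dp_value M X \<kappa> (max s (X i \<omega>)) (T - {i})) \<le> max s t + c"
    if i: "i \<in> T" for i
  proof -
    have int: "integrable M (\<lambda>\<omega>. max (X i \<omega> - t) 0)"
      using Suc.prems(1)[OF i] by (intro integrable_max) auto
    have "dp_value M X \<kappa> (max s (X i \<omega>)) (T - {i}) \<le> max s t + max (X i \<omega> - t) 0 + (c - e i)" for \<omega>
    proof -
      \<comment> \<open>If \<open>S\<close> is admissible for \<open>T - {i}\<close> with \<kappa>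
        probes, then \<open>insert i S\<close> is admissible for \<open>T\<close> with one more, so
        its total excess is at most \<open>c\<close>.\<close>
      have "dp_value M X \<kappa> (max s (X i \<omega>)) (T - {i}) \<le> max (max s (X i \<omega>)) t + (c - e i)"
      proof (rule Suc.IH)
        fix S assume S: "S \<subseteq> T - {i}" "card S = \<kappa>"
        then have "finite S" "i \<notin> S" using Suc.prems(2) finite_subset by auto
        moreover from this have "sum e (insert i S) \<le> c"
          using Suc.prems(4)[of "insert i S"] S i by (auto simp: e_def)
        ultimately show "(\<Sum>i\<in>S. expectation (\<lambda>\<omega>. max (X i \<omega> - t) 0)) \<le> c - e i"
          by (simp add: e_def)
      qed (use Suc.prems i in auto)
      \<comment> \<open>Pointwise, \<open>max (max s x) t\<close> \<le>
        \<open>max s t + max (x - t) 0\<close>. Taking expectations then turns the last term into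
        \<open>e i\<close>, which cancels.\<close>
      then show ?thesis by (auto simp: max_def split: if_splits)
    qed
    then have "expectation (\<lambda>\<omega>. dp_value M X \<kappa> (max s (X i \<omega>)) (T - {i}))
        \<le> expectation (\<lambda>\<omega>. max s t + max (X i \<omega> - t) 0 + (c - e i))"
      using Suc.prems i int by (intro integral_mono dp_step_integrable) auto
    also have "\<dots> = max s t + c"
      using int by (simp add: prob_space e_def)
    finally show ?thesis .
  qed
  have "T \<noteq> {}" using Suc.prems(3) by auto
  then show ?case
    using Suc.prems(2) step by (simp add: Max_le_iff)
qed

text \<open>The first sample is almost surely at least 0 and so overrides any nonpositive start.
  Without a probe the value would be \<open>s\<close> itself.\<close>

lemma dp_value_nonpos_start:
  assumes "\<And>i. i \<in> T \<Longrightarrow> integrable M (X i)" "finite T" "1 \<le> \<kappa>" "\<kappa> \<le> card T"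
    and "\<And>i. i \<in> T \<Longrightarrow> AE \<omega> in M. 0 \<le> X i \<omega>" and "s \<le> 0"
  shows "dp_value M X \<kappa> s T = dp_value M X \<kappa> 0 T"
proof -
  obtain m where m: "\<kappa> = Suc m" using assms(3) by (cases \<kappa>) auto
  have "expectation (\<lambda>\<omega>. dp_value M X m (max s (X i \<omega>)) (T - {i}))
      = expectation (\<lambda>\<omega>. dp_value M X m (max 0 (X i \<omega>)) (T - {i}))" if i: "i \<in> T" for i
  proof (rule integral_cong_AE)
    have "integrable M (\<lambda>\<omega>. dp_value M X m (max r (X i \<omega>)) (T - {i}))" for r
      by (rule dp_step_integrable) (use assms i m in auto)
    then show "(\<lambda>\<omega>. dp_value M X m (max s (X i \<omega>)) (T - {i})) \<in> borel_measurable M"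
      "(\<lambda>\<omega>. dp_value M X m (max 0 (X i \<omega>)) (T - {i})) \<in> borel_measurable M" by auto
    show "AE \<omega> in M. dp_value M X m (max s (X i \<omega>)) (T - {i})
        = dp_value M X m (max 0 (X i \<omega>)) (T - {i})"
      using assms(5)[OF i] by eventually_elim (use assms(6) in \<open>simp add: max_def\<close>)
  qed
  then show ?thesis by (simp add: m cong: image_cong_simp)
qed

end

theorem theorem1:
  fixes M :: "'a measure" and X :: "nat \<Rightarrow> 'a \<Rightarrow> real" and n k :: nat
  assumes "prob_space M"
    and "1 \<le> k" and "k \<le> n"
    and "prob_space.indep_vars M (\<lambda>_. borel) X {1..n}"
    and "\<And>i. i \<in> {1..n} \<Longrightarrow> AE \<omega> in M. 0 \<le> X i \<omega>"
    and "\<And>i. i \<in> {1..n} \<Longrightarrow> integrable M (X i)"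
  shows "adaptive_opt M X n k \<le> upper_opt M X n k"
proof -
  interpret prob_space M by fact
  have "policy_value M X P k 0 {1..n} \<le> threshold_bound M X n k t"
    if P: "P \<in> probing_policies n k" for P t
  proof -
    have fin: "finite {S. S \<subseteq> {1..n} \<and> card S = k}"
      by (rule finite_subset[of _ "Pow {1..n}"]) auto
    have "policy_value M X P k 0 {1..n} \<le> dp_value M X k 0 {1..n}"
      by (rule policy_value_le_dp_value[OF assms(6) P]) (use assms in auto)
    \<comment> \<open>For \<open>t < 0\<close>, starting from 0 would only give
      \<open>max 0 t = 0\<close> in place of \<open>t\<close>, a bound too large by
      \<open>- t\<close>.\<close>
    also have "\<dots> = dp_value M X k (min t 0) {1..n}"
      by (rule dp_value_nonpos_start[symmetric]) (use assms in auto)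
    \<comment> \<open>Here \<open>c\<close> is the largest total expected excess over
      \<open>t\<close> of a set of size \<open>k\<close>.\<close>
    also have "\<dots> \<le> max (min t 0) t + (threshold_bound M X n k t - t)"
    proof (rule dp_value_le_threshold)
      fix S assume "S \<subseteq> {1..n}" "card S = k"
      then have "t + (\<Sum>i\<in>S. expectation (\<lambda>\<omega>. max (X i \<omega> - t) 0)) \<le> threshold_bound M X n k t"
        unfolding threshold_bound_def using fin by (intro Max_ge) auto
      then show "(\<Sum>i\<in>S. expectation (\<lambda>\<omega>. max (X i \<omega> - t) 0)) \<le> threshold_bound M X n k t - t"
        by simp
    qed (use assms in auto)
    finally show ?thesis by simp
  qed
  moreover have "probing_policies n k \<noteq> {}" using dp_policy_in by blast
  ultimately show ?thesis
    unfolding adaptive_opt_def upper_opt_def by (intro cSUP_least cINF_greatest) auto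
qed

end
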